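(* For every integer $n\geq 3$ there is an integer $s_0$ (depending on $n$) such that for all integers $s\geq s_0$ one has $$e_{n,1,s}=g_{n,1,s}.$$
   Context: For integers $n\geq 2r+1$, $r\geq 0$, $s\geq 1$, $m\geq 1$ let $$c_{n,r,m,t}=\sum_{0\leq i<m}\binom{t-i+r}{r}\binom{i+n-r-1}{n-r-1},$$ regarded as a polynomial in $t$ (with $\binom{x+a}{a}=\frac{(x+a)\cdots(x+1)}{a!}$), and let $P_{n,r,s,m}(t)=\binom{t+n}{n}-s\,c_{n,r,m,t}$, a polynomial in $t$ of degree $n$. Substituting $t=m\tau$, the expression $P_{n,r,s,m}(m\tau)$ is a polynomial in $m$ of degree $n$ with coefficients in $\mathbb{Q}[\tau]$; $\Lambda_{n,r,s}(\tau)\in\mathbb{Q}[\tau]$ denotes the coefficient of $m^n$ in it. $g_{n,r,s}$ denotes the largest real root of $\Lambda_{n,r,s}$. Further, $$e_{n,r,s}=\inf\left\{\tfrac{t}{m}:\ t,m\in\mathbb{Z},\ t\geq m\geq 1,\ P_{n,r,s,m}(t)>0\right\}.$$ *)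

theory Defs
  imports Complex_Main "HOL-Computational_Algebra.Polynomial"
begin

text \<open>\<open>binom_poly x a\<close> is $\binom{x+a}{a} = (x+a)\cdots(x+1)/a!$ for \<open>x\<close> in \<open>\<rat>[t]\<close>.\<close>

definition binom_poly :: "rat poly \<Rightarrow> nat \<Rightarrow> rat poly" where
  "binom_poly x a = smult (1 / fact a) (\<Prod>j=1..a. x + of_nat j)"

definition c_poly :: "nat \<Rightarrow> nat \<Rightarrow> nat \<Rightarrow> rat poly" where
  "c_poly n r m =
     (\<Sum>i<m. binom_poly ([:0, 1:] - of_nat i) r * of_nat ((i + (n - r - 1)) choose (n - r - 1)))"

definition P_poly :: "nat \<Rightarrow> nat \<Rightarrow> nat \<Rightarrow> nat \<Rightarrow> rat poly" where
  "P_poly n r s m = binom_poly [:0, 1:] n - of_nat s * c_poly n r m"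

text \<open>
  The outer indeterminate of a \<open>rat poly poly\<close> below is \<open>m\<close>, the inner one is \<open>\<tau>\<close>.
  The index \<open>m\<close> of \<^const>\<open>P_poly\<close> is a summation bound, so
  \<open>P_poly n r s m\<close> at \<open>t = m\<tau>\<close> is turned into an element of \<open>\<rat>[\<tau>][m]\<close> by
  taking the polynomial that has the right value in \<open>\<rat>[\<tau>]\<close> at every integer \<open>m \<ge> 1\<close>.
\<close>

definition P_scaled :: "nat \<Rightarrow> nat \<Rightarrow> nat \<Rightarrow> rat poly poly" where
  "P_scaled n r s =
     (THE Q. \<forall>m\<ge>1. poly Q (of_nat m) = pcompose (P_poly n r s m) [:0, of_nat m:])"

definition Lambda :: "nat \<Rightarrow> nat \<Rightarrow> nat \<Rightarrow> rat poly" where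
  "Lambda n r s = coeff (P_scaled n r s) n"

text \<open>
  The root set below is finite whenever \<open>Lambda n r s \<noteq> 0\<close>, so \<^const>\<open>Max\<close> is then its greatest
  element as soon as there is a real root; the intended parameters are \<open>n \<ge> 2 * r + 1\<close>, \<open>s \<ge> 1\<close>.
\<close>

definition g_root :: "nat \<Rightarrow> nat \<Rightarrow> nat \<Rightarrow> real" where
  "g_root n r s = Max {x :: real. poly (map_poly of_rat (Lambda n r s)) x = 0}"

definition e_inf :: "nat \<Rightarrow> nat \<Rightarrow> nat \<Rightarrow> real" where
  "e_inf n r s =
     Inf {real_of_int t / real m | (t :: int) (m :: nat).
            t \<ge> int m \<and> m \<ge> 1 \<and> poly (P_poly n r s m) (of_int t) > 0}"

subsection \<open>\<open>P_scaled\<close> is well defined\<close>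

lemma power_sum_poly:
  "\<exists>Q :: rat poly poly. \<forall>m. poly Q (of_nat m) = (\<Sum>i<m. of_nat i ^ k)"
proof (induction k rule: less_induct)
  case (less k)
  then obtain S :: "nat \<Rightarrow> rat poly poly"
    where S: "\<And>j m. j < k \<Longrightarrow> poly (S j) (of_nat m) = (\<Sum>i<m. of_nat i ^ j)"
    by metis
  let ?c = "[:1 / of_nat (Suc k):] :: rat poly"
  define Q where "Q = [:?c:] * (monom 1 (Suc k) - (\<Sum>j<k. of_nat (Suc k choose j) * S j))"
  have "poly Q (of_nat m) = (\<Sum>i<m. of_nat i ^ k)" for m
  proof -
    have bin: "of_nat (Suc i) ^ Suc k - of_nat i ^ Suc k =
        (\<Sum>j<k. of_nat (Suc k choose j) * of_nat i ^ j) + of_nat (Suc k) * (of_nat i :: rat poly) ^ k" for i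
    proof -
      have "(of_nat i + 1 :: rat poly) ^ Suc k =
          (\<Sum>j\<le>Suc k. of_nat (Suc k choose j) * of_nat i ^ j)"
        by (subst binomial_ring) simp
      also have "\<dots> = (\<Sum>j<k. of_nat (Suc k choose j) * of_nat i ^ j)
          + of_nat (Suc k) * of_nat i ^ k + of_nat i ^ Suc k"
        by (simp only: lessThan_Suc_atMost [symmetric] sum.lessThan_Suc) simp
      finally show ?thesis by (simp add: add.commute)
    qed
    have "(of_nat m :: rat poly) ^ Suc k = (\<Sum>i<m. of_nat (Suc i) ^ Suc k - of_nat i ^ Suc k)"
      by (subst sum_lessThan_telescope) simp
    also have "\<dots> = (\<Sum>i<m. \<Sum>j<k. of_nat (Suc k choose j) * of_nat i ^ j)
        + of_nat (Suc k) * (\<Sum>i<m. of_nat i ^ k)"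
      by (simp only: bin sum.distrib sum_distrib_left)
    also have "(\<Sum>i<m. \<Sum>j<k. of_nat (Suc k choose j) * of_nat i ^ j) =
        (\<Sum>j<k. of_nat (Suc k choose j) * (\<Sum>i<m. (of_nat i :: rat poly) ^ j))"
      by (subst sum.swap) (simp only: sum_distrib_left)
    also have "\<dots> = (\<Sum>j<k. of_nat (Suc k choose j) * poly (S j) (of_nat m))"
      by (intro sum.cong) (auto simp: S)
    finally have "(of_nat m :: rat poly) ^ Suc k - (\<Sum>j<k. of_nat (Suc k choose j) * poly (S j) (of_nat m))
        = of_nat (Suc k) * (\<Sum>i<m. of_nat i ^ k)" by simp
    moreover have "poly Q (of_nat m) =
        ?c * ((of_nat m :: rat poly) ^ Suc k - (\<Sum>j<k. of_nat (Suc k choose j) * poly (S j) (of_nat m)))"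
      by (simp add: Q_def poly_monom poly_sum del: of_nat_Suc power_Suc binomial_Suc_Suc)
    ultimately have "poly Q (of_nat m) = (?c * of_nat (Suc k)) * (\<Sum>i<m. of_nat i ^ k)"
      by (simp only: mult.assoc)
    also have "?c * of_nat (Suc k) = 1"
      by (simp add: of_nat_poly del: of_nat_Suc)
    finally show ?thesis by simp
  qed
  then show ?case by blast
qed

lemma sum_poly_poly:
  fixes B :: "rat poly poly poly"
  shows "\<exists>Q. \<forall>m. poly Q (of_nat m) = (\<Sum>i<m. poly (poly B (of_nat i)) (of_nat m))"
proof -
  obtain S :: "nat \<Rightarrow> rat poly poly" where S: "\<And>k m. poly (S k) (of_nat m) = (\<Sum>i<m. of_nat i ^ k)"
    using power_sum_poly by metis
  have "poly (\<Sum>k\<le>degree B. coeff B k * S k) (of_nat m)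
      = (\<Sum>i<m. poly (poly B (of_nat i)) (of_nat m))" for m
  proof -
    have "(\<Sum>i<m. poly (poly B (of_nat i)) (of_nat m)) =
        (\<Sum>i<m. \<Sum>k\<le>degree B. poly (coeff B k) (of_nat m) * of_nat i ^ k)"
      by (subst poly_altdef) (simp add: poly_sum)
    also have "\<dots> = (\<Sum>k\<le>degree B. poly (coeff B k) (of_nat m) * (\<Sum>i<m. of_nat i ^ k))"
      by (subst sum.swap) (simp add: sum_distrib_left)
    finally show ?thesis by (simp add: poly_sum S)
  qed
  then show ?thesis by blast
qed

lemma pcompose_binom_poly:
  "pcompose (binom_poly x a) q = binom_poly (pcompose x q) a"
  by (simp add: binom_poly_def pcompose_smult pcompose_prod pcompose_add of_nat_poly pcompose_const)

lemma P_scaled_exists: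
  "\<exists>Q. \<forall>m. poly Q (of_nat m) = pcompose (P_poly n r s m) [:0, of_nat m:]"
proof -
  define a where "a = n - r - 1"
  define A :: "rat poly poly" where
    "A = [:[:1 / fact n:]:] * (\<Prod>j=1..n. [:0, [:0, 1:]:] + of_nat j)"
  define B :: "rat poly poly poly" where
    "B = [:[:[:1 / fact r:]:]:] * (\<Prod>j=1..r. [:[:0, [:0, 1:]:], -1:] + of_nat j) *
         ([:[:[:1 / fact a:]:]:] * (\<Prod>j=1..a. [:0, 1:] + of_nat j))"
  have A: "poly A (of_nat m) = binom_poly [:0, of_nat m:] n" for m
    by (simp add: A_def binom_poly_def poly_prod of_nat_poly)
  have ch: "[:1 / fact a:] * (\<Prod>j=1..a. of_nat i + of_nat j) =
      (of_nat ((i + a) choose a) :: rat poly)" for i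
  proof -
    have "(of_nat ((i + a) choose a) :: rat) = (1 / fact a) * (\<Prod>j=1..a. of_nat i + of_nat j)"
    proof (induction a)
      case (Suc a)
      have "Suc a * ((i + Suc a) choose Suc a) = (i + Suc a) * ((i + a) choose a)"
        using Suc_times_binomial_eq [of "i + a" a] by (simp add: ac_simps)
      then have "of_nat (Suc a) * (of_nat ((i + Suc a) choose Suc a) :: rat)
          = of_nat (i + Suc a) * of_nat ((i + a) choose a)"
        by (metis of_nat_mult)
      then have "(of_nat ((i + Suc a) choose Suc a) :: rat)
          = of_nat (i + Suc a) * of_nat ((i + a) choose a) / of_nat (Suc a)"
        by (simp add: eq_divide_eq mult.commute del: of_nat_Suc of_nat_add binomial_Suc_Suc add_Suc_right)
      also have "\<dots> = (1 / fact (Suc a)) * (\<Prod>j=1..Suc a. of_nat i + of_nat j)"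
        by (simp add: Suc.IH fact_Suc mult_ac del: of_nat_Suc)
      finally show ?case .
    qed simp
    moreover have "(\<Prod>j=1..a. of_nat i + of_nat j :: rat poly) = [:\<Prod>j=1..a. of_nat i + of_nat j:]"
      by (induction a) (auto simp: of_nat_poly)
    ultimately show ?thesis by (simp add: of_nat_poly)
  qed
  have B: "poly (poly B (of_nat i)) (of_nat m) =
      binom_poly ([:0, of_nat m:] - of_nat i) r * of_nat ((i + a) choose a)" for i m
    unfolding ch [symmetric]
    by (simp add: B_def binom_poly_def poly_prod of_nat_poly add.commute)
  obtain Q where Q: "\<And>m. poly Q (of_nat m) = (\<Sum>i<m. poly (poly B (of_nat i)) (of_nat m))"
    using sum_poly_poly [of B] by blast
  have "poly (A - of_nat s * Q) (of_nat m) = pcompose (P_poly n r s m) [:0, of_nat m:]" for m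
  proof -
    have const: "pcompose (of_nat k) q = of_nat k" for k and q :: "rat poly"
      by (simp add: of_nat_poly)
    have X: "pcompose [:0, 1:] q = q" for q :: "rat poly"
      by (simp add: pcompose_pCons)
    show ?thesis
      unfolding P_poly_def c_poly_def poly_diff poly_mult poly_of_nat A Q B
      by (simp only: pcompose_diff pcompose_mult pcompose_sum pcompose_binom_poly X const a_def)
  qed
  then show ?thesis by blast
qed

lemma poly_eq_of_nat_cofinite:
  fixes Q R :: "rat poly poly"
  assumes "\<forall>m\<ge>1. poly Q (of_nat m) = poly R (of_nat m)"
  shows "Q = R"
proof (rule ccontr)
  assume "Q \<noteq> R"
  then have "finite {x. poly (Q - R) x = 0}"
    by (intro poly_roots_finite) simp
  moreover have "(of_nat :: nat \<Rightarrow> rat poly) ` {1..} \<subseteq> {x. poly (Q - R) x = 0}"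
    using assms by auto
  ultimately have "finite ((of_nat :: nat \<Rightarrow> rat poly) ` {1..})"
    by (rule rev_finite_subset)
  moreover have "inj_on (of_nat :: nat \<Rightarrow> rat poly) {1..}"
    by (auto simp: inj_on_def of_nat_poly)
  ultimately show False
    using finite_imageD infinite_Ici by blast
qed

theorem P_scaled_ex1:
  "\<exists>!Q. \<forall>m\<ge>1. poly Q (of_nat m) = pcompose (P_poly n r s m) [:0, of_nat m:]"
  using P_scaled_exists [of n r s]
  by (intro ex_ex1I) (blast, rule poly_eq_of_nat_cofinite, simp)

lemma poly_P_scaled:
  "m \<ge> 1 \<Longrightarrow> poly (P_scaled n r s) (of_nat m) = pcompose (P_poly n r s m) [:0, of_nat m:]"
  using theI' [OF P_scaled_ex1 [of n r s]] unfolding P_scaled_def by blast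

end

theory Submission
  imports Defs "HOL-Analysis.Convex"
begin

text \<open>
  For \<open>r = 1\<close> the sum defining \<open>c\<close> telescopes, and with rising factorials
  \[ n!\,P_{n,1,s,m}(t) = (t+1)\cdots(t+n)
       - s\,m(m+1)\cdots(m+n-2)\,\bigl(nt-(n-1)m+2n-1\bigr). \]
  Hence \<open>n! \<Lambda>(\<tau>) = \<tau>^n - s (n\<tau> - (n-1))\<close>. Write \<open>g\<close> for its largest root; it tends to infinity
  with \<open>s\<close>, and \<open>s \<ge> (n(n+1))^n\<close> already forces \<open>g \<ge> n(n+1)\<close>.

  The inequality \<open>e \<le> g\<close> holds because \<open>\<Lambda>\<close> is positive to the right of \<open>g\<close>: for a rational
  \<open>\<tau> > g\<close> the leading term \<open>\<Lambda>(\<tau>) m^n\<close> makes \<open>P(m\<tau>)\<close> positive for large \<open>m\<close>, and these \<open>m\<close> may be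
  taken divisible by the denominator of \<open>\<tau>\<close> (\<open>P_pos_eventually\<close>).

  For \<open>e \<ge> g\<close> one needs \<open>P(t) \<le> 0\<close> whenever \<open>m \<le> t \<le> gm\<close>, with a bound on \<open>s\<close> that is uniform
  in \<open>m\<close> (\<open>P_nonpos_below_root\<close>). On \<open>t \<ge> 0\<close> the positive part of \<open>P\<close> is convex and the negative
  part is affine, so only the end points matter. At \<open>t = m\<close> it is enough that \<open>s \<ge> n\<close>. At \<open>t = gm\<close> the
  terms of top degree in \<open>m\<close> cancel, and the lower order terms are to be compared:
  the positive part carries the relative correction
  \[ \prod_{j=1}^n \Bigl(1+\frac{j}{gm}\Bigr) \le \exp\Bigl(\frac{n(n+1)}{2gm}\Bigr)
       \le \exp\Bigl(\frac1{2m}\Bigr) \le 1 + \frac1m, \]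
  whereas the negative part contains the factor \<open>m + 1\<close>, which alone contributes \<open>1 + 1/m\<close>.
  This is where \<open>n \<ge> 3\<close> enters: for \<open>n = 2\<close> the product \<open>m \<cdots> (m+n-2)\<close> is just \<open>m\<close>.
\<close>

section \<open>A closed form of the polynomial\<close>

lemma poly_pochhammer: "poly (pochhammer p n) x = pochhammer (poly p x) n"
  by (simp add: pochhammer_prod poly_prod)

lemma poly_binom_poly: "fact a * poly (binom_poly p a) x = pochhammer (poly p x + 1) a"
  by (simp add: binom_poly_def poly_prod pochhammer_prod add_ac
      prod.atLeast1_atMost_eq lessThan_atLeast0)

text \<open>
  By induction on \<open>m\<close>: the binomial coefficient in the last summand and the rising factorials for
  \<open>m\<close> and \<open>m + 1\<close> share the factor \<open>(m+1) \<cdots> (m+k)\<close>, and what remains is an identity between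
  polynomials of degree two. The shift \<open>n = k + 2\<close> avoids truncated subtraction.
\<close>

lemma fact_c_poly_eq:
  fixes x :: rat
  shows "fact (k + 2) * poly (c_poly (k + 2) 1 m) x =
    pochhammer (of_nat m) (k + 1) * (of_nat (k + 2) * x - of_nat (k + 1) * of_nat m + of_nat (2 * k + 3))"
proof (induction m)
  case 0
  then show ?case by (simp add: c_poly_def pochhammer_rec)
next
  case (Suc m)
  let ?q = "pochhammer (of_nat m + 1) k :: rat"
  have "of_nat ((m + k) choose k) = ?q / fact k"
    by (simp add: binomial_gbinomial gbinomial_pochhammer')
  then have "of_nat (k + 2) * of_nat (k + 1) * (fact k * of_nat ((m + k) choose k)) =
      of_nat (k + 2) * of_nat (k + 1) * ?q"
    by simp
  then have choose: "fact (k + 2) * of_nat ((m + k) choose k) = of_nat (k + 2) * of_nat (k + 1) * ?q"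
    by (simp add: mult_ac)
  have "fact (k + 2) * poly (c_poly (k + 2) 1 (Suc m)) x =
      fact (k + 2) * poly (c_poly (k + 2) 1 m) x
      + (x - of_nat m + 1) * (fact (k + 2) * of_nat ((m + k) choose k))"
    by (simp add: c_poly_def binom_poly_def of_nat_poly algebra_simps)
  also have "\<dots> = of_nat m * ?q * (of_nat (k + 2) * x - of_nat (k + 1) * of_nat m + of_nat (2 * k + 3))
      + (x - of_nat m + 1) * (of_nat (k + 2) * of_nat (k + 1) * ?q)"
    unfolding Suc.IH choose by (simp add: pochhammer_rec)
  also have "\<dots> = ?q * (of_nat m + 1 + of_nat k)
      * (of_nat (k + 2) * x - of_nat (k + 1) * of_nat (Suc m) + of_nat (2 * k + 3))"
    by (simp add: algebra_simps)
  also have "?q * (of_nat m + 1 + of_nat k) = pochhammer (of_nat (Suc m)) (k + 1)"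
    by (simp add: pochhammer_Suc add_ac)
  finally show ?case .
qed

lemma fact_P_poly_eq:
  fixes x :: rat
  assumes "n \<ge> 2"
  shows "fact n * poly (P_poly n 1 s m) x = pochhammer (x + 1) n - of_nat s *
    (pochhammer (of_nat m) (n - 1) * (of_nat n * x - (of_nat n - 1) * of_nat m + (2 * of_nat n - 1)))"
proof -
  from assms obtain k where n: "n = k + 2"
    by (metis add.commute le_Suc_ex)
  have "fact n * poly (P_poly n 1 s m) x =
      fact n * poly (binom_poly [:0, 1:] n) x - of_nat s * (fact n * poly (c_poly n 1 m) x)"
    by (simp add: P_poly_def algebra_simps)
  also have "\<dots> = pochhammer (x + 1) n - of_nat s *
    (pochhammer (of_nat m) (n - 1) * (of_nat n * x - (of_nat n - 1) * of_nat m + (2 * of_nat n - 1)))"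
    unfolding poly_binom_poly unfolding n fact_c_poly_eq by (simp add: algebra_simps)
  finally show ?thesis .
qed

section \<open>The leading coefficient and its largest root\<close>

lemma pochhammer_linear_poly:
  fixes b c :: "'a :: idom"
  shows "degree (pochhammer [:c, b:] n) \<le> n" and "coeff (pochhammer [:c, b:] n) n = b ^ n"
proof -
  have "degree (pochhammer [:c, b:] n) \<le> n \<and> coeff (pochhammer [:c, b:] n) n = b ^ n"
  proof (induction n)
    case (Suc n)
    have lin: "[:c, b:] + of_nat n = [:c + of_nat n, b:]"
      by (simp add: of_nat_poly)
    have "degree (pochhammer [:c, b:] n * [:c + of_nat n, b:]) \<le> n + 1"
      using Suc by (intro order.trans [OF degree_mult_le] add_mono) auto
    moreover have "coeff (pochhammer [:c, b:] n) (Suc n) = 0"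
      using Suc by (intro coeff_eq_0) auto
    ultimately show ?case
      using Suc by (simp add: pochhammer_Suc lin mult.commute)
  qed simp
  then show "degree (pochhammer [:c, b:] n) \<le> n" "coeff (pochhammer [:c, b:] n) n = b ^ n"
    by auto
qed

text \<open>
  The closed form, read as a polynomial in \<open>m\<close> with \<open>t = m\<tau>\<close>, is built from linear factors
  \<open>\<tau>m + j\<close> and \<open>m + j\<close>, and \<open>(n\<tau> - (n-1))m + (2n-1)\<close>; so the coefficient of \<open>m^n\<close> is found by
  multiplying their leading coefficients.
\<close>

lemma Lambda_eq:
  assumes "n \<ge> 2"
  shows "Lambda n 1 s = smult (1 / fact n) (monom 1 n - smult (of_nat s) [:1 - of_nat n, of_nat n:])"
proof -
  define A :: "rat poly poly" where "A = pochhammer [:1, [:0, 1:]:] n"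
  define B :: "rat poly poly" where "B = pochhammer [:0, 1:] (n - 1)"
  define L :: "rat poly poly" where "L = [:[:2 * of_nat n - 1:], [:1 - of_nat n, of_nat n:]:]"
  have "smult [:fact n:] (P_scaled n 1 s) = A - smult (of_nat s) (B * L)"
  proof (rule poly_eq_of_nat_cofinite, intro allI impI)
    fix m :: nat assume "m \<ge> 1"
    show "poly (smult [:fact n:] (P_scaled n 1 s)) (of_nat m) =
      poly (A - smult (of_nat s) (B * L)) (of_nat m)"
    proof (rule poly_eq_poly_eq_iff [THEN iffD1], rule ext)
      fix x :: rat
      have "poly (poly (smult [:fact n:] (P_scaled n 1 s)) (of_nat m)) x =
          fact n * poly (P_poly n 1 s m) (of_nat m * x)"
        using \<open>m \<ge> 1\<close> by (simp add: poly_P_scaled poly_pcompose mult.commute)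
      also have "\<dots> = poly (poly (A - smult (of_nat s) (B * L)) (of_nat m)) x"
        unfolding fact_P_poly_eq [OF assms]
        by (simp add: A_def B_def L_def poly_pochhammer algebra_simps)
      finally show "poly (poly (smult [:fact n:] (P_scaled n 1 s)) (of_nat m)) x =
          poly (poly (A - smult (of_nat s) (B * L)) (of_nat m)) x" .
    qed
  qed
  then have "coeff (smult [:fact n:] (P_scaled n 1 s)) n = coeff (A - smult (of_nat s) (B * L)) n"
    by simp
  moreover have "coeff (B * L) n = [:1 - of_nat n, of_nat n:]"
  proof -
    obtain j where j: "n = Suc j"
      using assms by (cases n) auto
    have "coeff B n = 0"
      unfolding B_def using pochhammer_linear_poly(1) [of 0 "1 :: rat poly" j]
      by (intro coeff_eq_0) (simp add: j)
    moreover have "coeff B j = 1"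
      using pochhammer_linear_poly(2) [of 0 "1 :: rat poly" j] by (simp add: B_def j)
    ultimately show ?thesis
      by (simp add: L_def j mult.commute)
  qed
  moreover have "coeff A n = monom 1 n"
    using pochhammer_linear_poly(2) [of 1 "[:0, 1 :: rat:]" n] by (simp add: A_def monom_altdef)
  ultimately have "smult (fact n) (Lambda n 1 s) = monom 1 n - smult (of_nat s) [:1 - of_nat n, of_nat n:]"
    by (simp add: Lambda_def of_nat_poly)
  then have "smult (1 / fact n) (smult (fact n) (Lambda n 1 s)) =
      smult (1 / fact n) (monom 1 n - smult (of_nat s) [:1 - of_nat n, of_nat n:])"
    by simp
  then show ?thesis by simp
qed

lemma poly_real_Lambda:
  assumes "n \<ge> 2"
  shows "fact n * poly (map_poly of_rat (Lambda n 1 s)) (x :: real) =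
    x ^ n - real s * (real n * x - (real n - 1))"
proof -
  have fact: "of_rat (fact n) = (fact n :: real)"
    by (metis of_nat_fact of_rat_of_nat_eq)
  have "map_poly of_rat (Lambda n 1 s) =
      smult (1 / fact n) (monom 1 n - smult (real s) [:1 - real n, real n:])"
    unfolding Lambda_eq [OF assms]
    by (rule poly_eqI)
      (auto simp: coeff_map_poly coeff_pCons of_rat_divide of_rat_mult
        of_rat_diff fact simp del: fact_Suc split: nat.split)
  then show ?thesis
    by (simp add: poly_monom algebra_simps)
qed

text \<open>
  The sign condition in \<^const>\<open>e_inf\<close> is about rationals; the estimates below need reals, as
  they evaluate the same expressions at multiples of \<open>g\<close>.
\<close>

lemma P_poly_pos_iff:
  assumes "n \<ge> 2"
  shows "poly (P_poly n 1 s m) (of_int t) > 0 \<longleftrightarrow>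
    real s * (pochhammer (real m) (n - 1) * (real n * of_int t - (real n - 1) * real m + (2 * real n - 1)))
      < pochhammer (of_int t + 1) n"
proof -
  have of_rat_poch: "of_rat (pochhammer y k) = (pochhammer (of_rat y) k :: real)" for y k
    by (induction k) (simp_all add: pochhammer_Suc of_rat_mult of_rat_add)
  have "poly (P_poly n 1 s m) (of_int t) > 0 \<longleftrightarrow>
      (of_rat (fact n * poly (P_poly n 1 s m) (of_int t)) :: real) > 0"
    by (simp add: zero_less_mult_iff)
  also have "(of_rat (fact n * poly (P_poly n 1 s m) (of_int t)) :: real) =
      pochhammer (of_int t + 1) n - real s *
      (pochhammer (real m) (n - 1) * (real n * of_int t - (real n - 1) * real m + (2 * real n - 1)))"
    unfolding fact_P_poly_eq [OF assms]
    by (simp add: of_rat_diff of_rat_mult of_rat_add of_rat_poch)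
  finally show ?thesis by simp
qed

text \<open>
  The polynomial \<open>f = n! \<Lambda>\<close> is positive near infinity, so by the intermediate value theorem every
  point with \<open>f \<le> 0\<close> has a root to its right. Applied to \<open>K\<close> this gives a root that is at least
  \<open>K\<close>; applied to a point beyond the largest root it gives a contradiction.
\<close>

lemma g_root_largest:
  fixes K :: real
  assumes n: "n \<ge> 2" and K: "K \<ge> 1" and s: "K ^ n \<le> real s"
  shows "K \<le> g_root n 1 s"
    and "g_root n 1 s ^ n = real s * (real n * g_root n 1 s - (real n - 1))"
    and "\<And>x. x > g_root n 1 s \<Longrightarrow> real s * (real n * x - (real n - 1)) < x ^ n"
proof -
  define f where "f x = x ^ n - real s * (real n * x - (real n - 1))" for x
  define R where "R = {x :: real. poly (map_poly of_rat (Lambda n 1 s)) x = 0}"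
  have R: "R = {x. f x = 0}"
    unfolding R_def f_def poly_real_Lambda [OF n, symmetric] by simp
  have cont: "continuous_on A f" for A
    unfolding f_def by (intro continuous_intros)
  have ev: "eventually (\<lambda>x. f x > 0) at_top"
  proof (rule eventually_mono [OF eventually_gt_at_top])
    fix x :: real assume x: "x > 1 + real s * real n"
    have "1 \<le> x" 
      using x by (smt (verit) of_nat_0_le_iff zero_le_mult_iff)
    have "real s * (real n * x - (real n - 1)) \<le> real s * (real n * x)"
      using n by (intro mult_left_mono) auto
    also have "\<dots> = (real s * real n) * x"
      by simp
    also have "\<dots> < x * x"
      using x \<open>1 \<le> x\<close> by (intro mult_strict_right_mono) auto
    also have "\<dots> \<le> x ^ n"
      using power_increasing [OF n \<open>1 \<le> x\<close>] by (simp add: power2_eq_square)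
    finally show "f x > 0" by (simp add: f_def)
  qed
  have root_above: "\<exists>x\<ge>a. f x = 0" if "f a \<le> 0" for a
  proof -
    have "eventually (\<lambda>x. f x > 0 \<and> x \<ge> a) at_top"
      by (intro eventually_conj ev eventually_ge_at_top)
    then obtain b where "b \<ge> a" "f b > 0"
      using eventually_happens' [OF trivial_limit_at_top_linorder] by blast
    then show ?thesis
      using IVT' [of f a 0 b] that cont by auto
  qed
  have "f K \<le> 0"
  proof -
    have "1 * 1 \<le> real n * K - (real n - 1)"
    proof -
      have "real n * 1 \<le> real n * K" using K by (intro mult_left_mono) auto
      then show ?thesis by simp
    qed
    then have "real s * 1 \<le> real s * (real n * K - (real n - 1))"
      by (intro mult_left_mono) auto
    then show ?thesis using s by (simp add: f_def)
  qed
  have "map_poly of_rat (Lambda n 1 s) \<noteq> (0 :: real poly)"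
  proof
    assume "map_poly of_rat (Lambda n 1 s) = (0 :: real poly)"
    then have "f x = 0" for x
      using poly_real_Lambda [OF n, of s x] by (simp add: f_def)
    then show False using ev by simp
  qed
  then have fin: "finite R"
    unfolding R_def by (rule poly_roots_finite)
  obtain x0 where x0: "x0 \<ge> K" "x0 \<in> R"
    using root_above [OF \<open>f K \<le> 0\<close>] R by auto
  have g: "g_root n 1 s = Max R"
    by (simp add: g_root_def R_def)
  show "K \<le> g_root n 1 s"
    unfolding g using fin x0 by (meson Max_ge order_trans)
  have "Max R \<in> R"
    using fin x0 by (intro Max_in) auto
  then show "g_root n 1 s ^ n = real s * (real n * g_root n 1 s - (real n - 1))"
    unfolding g R f_def by simp
  show "real s * (real n * x - (real n - 1)) < x ^ n" if "x > g_root n 1 s" for x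
  proof (rule ccontr)
    assume "\<not> ?thesis"
    then have "f x \<le> 0" by (simp add: f_def)
    then obtain y where "y \<ge> x" "y \<in> R"
      using root_above R by auto
    then show False
      using Max_ge [OF fin \<open>y \<in> R\<close>] that g by simp
  qed
qed

section \<open>Nonpositivity up to the largest root\<close>

lemma convex_pochhammer: "convex_on {0..} (\<lambda>x :: real. pochhammer (x + 1) n)"
proof (induction n)
  case (Suc n)
  show ?case
    unfolding pochhammer_Suc
  proof (rule convex_on_mul [OF Suc])
    show "convex_on {0..} (\<lambda>x :: real. x + 1 + real n)"
      by (intro convex_on_add) (auto simp: convex_on_ident convex_on_const)
    show "mono_on {0..} (\<lambda>x :: real. pochhammer (x + 1) n)"
      by (auto simp: pochhammer_prod intro!: mono_onI prod_mono)
    show "(\<lambda>x :: real. pochhammer (x + 1) n) \<in> {0..} \<rightarrow> {0..}"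
      by (auto simp: pochhammer_prod intro!: prod_nonneg)
  qed (auto intro!: mono_onI)
qed (simp add: convex_on_const)

text \<open>
  Here \<open>\<Prod> (1 + j/(gm)) \<le> exp (\<Sum> j/(gm)) \<le> exp (1/(2m)) \<le> 1 + 1/m\<close>. The hypothesis on \<open>g\<close> is
  what turns the sum \<open>n(n+1)/(2gm)\<close> into at most \<open>1/(2m)\<close>, for every \<open>m\<close> at once.
\<close>

lemma pochhammer_scaled_le:
  fixes g :: real
  assumes m: "m \<ge> 1" and g: "real (n * (n + 1)) \<le> g" "g > 0"
  shows "pochhammer (g * real m + 1) n \<le> (g * real m) ^ n * (1 + 1 / real m)"
proof -
  define y where "y = g * real m"
  have "y > 0" using assms by (simp add: y_def)
  have "pochhammer (y + 1) n = (\<Prod>j=1..n. y * (1 + real j / y))"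
    unfolding pochhammer_prod One_nat_def prod.atLeast1_atMost_eq lessThan_atLeast0
    using \<open>y > 0\<close> by (intro prod.cong) (auto simp: field_simps)
  also have "\<dots> = y ^ n * (\<Prod>j=1..n. 1 + real j / y)"
    by (simp add: prod.distrib)
  also have "(\<Prod>j=1..n. 1 + real j / y) \<le> (\<Prod>j=1..n. exp (real j / y))"
    using \<open>y > 0\<close> by (intro prod_mono) (auto intro: add_nonneg_nonneg)
  also have "\<dots> = exp (\<Sum>j=1..n. real j / y)"
    by (simp add: exp_sum)
  also have "(\<Sum>j=1..n. real j / y) = (real n * (real n + 1) / 2) / y"
    using double_gauss_sum_from_Suc_0 [of n, where 'a = real]
    by (simp add: sum_divide_distrib [symmetric] divide_simps mult_ac)
  also have "exp ((real n * (real n + 1) / 2) / y) \<le> exp (1 / (2 * real m))"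
  proof -
    have "real n * (real n + 1) / (2 * y) \<le> g / (2 * y)"
      using g \<open>y > 0\<close> by (intro divide_right_mono) (auto simp: algebra_simps)
    also have "\<dots> = 1 / (2 * real m)"
      using g m by (simp add: y_def)
    finally show ?thesis by simp
  qed
  also have "exp (1 / (2 * real m)) \<le> 1 + 1 / real m"
    using exp_bound_lemma [of "1 / (2 * real m)"] m by (simp add: divide_simps)
  finally show ?thesis
    using \<open>y > 0\<close> by (simp add: y_def)
qed

text \<open>
  All factors but \<open>x + 1\<close> are bounded below by \<open>x\<close>; keeping this one factor is enough to
  absorb the correction \<open>1 + 1/m\<close> above.
\<close>

lemma pochhammer_ge:
  fixes x :: real
  assumes "x > 0" shows "x ^ (k + 1) * (x + 1) \<le> pochhammer x (k + 2)"
proof (induction k)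
  case (Suc k)
  have "x ^ (k + 1) * (x + 1) * x \<le> pochhammer x (k + 2) * (x + real (k + 2))"
    using Suc assms by (intro mult_mono) (auto intro: pochhammer_nonneg)
  then show ?case by (simp add: pochhammer_Suc [of x "Suc (Suc k)"] mult_ac)
qed (simp add: pochhammer_Suc)

text \<open>
  The root equation \<open>g^n = s (ng - (n-1))\<close> identifies the terms of top degree on the two sides,
  so that the two preceding bounds can be compared; the summand \<open>2n - 1\<close> is simply dropped.
\<close>

lemma P_nonpos_at_root:
  fixes g :: real
  assumes n: "n \<ge> 3" and m: "m \<ge> 1" and g: "real (n * (n + 1)) \<le> g"
    and root: "g ^ n = real s * (real n * g - (real n - 1))"
  shows "pochhammer (g * real m + 1) n \<le> real s *
    (pochhammer (real m) (n - 1) * (real n * (g * real m) - (real n - 1) * real m + (2 * real n - 1)))"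
proof -
  from n obtain k where k: "n = k + 3"
    by (metis add.commute le_Suc_ex)
  have "1 * 1 \<le> n * (n + 1)" using n by (intro mult_le_mono) auto
  then have "1 \<le> g" using g by linarith
  then have "g > 0" by simp
  have "real n * 1 \<le> real n * g"
    using \<open>1 \<le> g\<close> by (intro mult_left_mono) auto
  have "pochhammer (g * real m + 1) n \<le> (g * real m) ^ n * (1 + 1 / real m)"
    by (rule pochhammer_scaled_le [OF m g \<open>g > 0\<close>])
  also have "\<dots> = (real m ^ (k + 1) * (real m + 1)) * (real m * g ^ n)"
    using m by (simp add: k power_mult_distrib field_simps power_add power3_eq_cube)
  also have "\<dots> = real s * ((real m ^ (k + 1) * (real m + 1)) * (real m * (real n * g - (real n - 1))))"
    unfolding root by simp
  also have "\<dots> \<le> real s * (pochhammer (real m) (k + 2) *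
      (real n * (g * real m) - (real n - 1) * real m + (2 * real n - 1)))"
  proof (intro mult_left_mono mult_mono)
    show "real m ^ (k + 1) * (real m + 1) \<le> pochhammer (real m) (k + 2)"
      using m by (intro pochhammer_ge) simp
    show "0 \<le> real m * (real n * g - (real n - 1))"
      using \<open>real n * 1 \<le> real n * g\<close> by (intro mult_nonneg_nonneg) auto
  qed (use n m in \<open>auto simp: algebra_simps intro!: pochhammer_nonneg\<close>)
  finally show ?thesis by (simp add: k)
qed

text \<open>
  After cancelling \<open>(m+1) \<cdots> (m+n-2)\<close> the claim is \<open>(m+n-1)(m+n) \<le> s m (m+2n-1)\<close>, and
  \<open>m+n-1 \<le> nm \<le> sm\<close>.
\<close>

lemma P_nonpos_at_diagonal:
  assumes n: "n \<ge> 2" and m: "m \<ge> 1" and s: "real n \<le> real s"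
  shows "pochhammer (real m + 1) n \<le> real s *
    (pochhammer (real m) (n - 1) * (real n * real m - (real n - 1) * real m + (2 * real n - 1)))"
proof -
  from n obtain k where k: "n = k + 2"
    by (metis add.commute le_Suc_ex)
  let ?p = "pochhammer (real m + 1) k"
  have "0 \<le> real k * (real m - 1)" using m by simp
  then have a: "real m + 1 + real k \<le> real n * real m" 
    using m by (simp add: k algebra_simps)
  have "0 \<le> ?p" by (intro pochhammer_nonneg) auto
  have "pochhammer (real m + 1) n = ?p * ((real m + 1 + real k) * (real m + 2 + real k))"
    by (simp add: k pochhammer_Suc algebra_simps)
  also have "\<dots> \<le> ?p * ((real s * real m) * (real m + (2 * real n - 1)))"
    using s a \<open>0 \<le> ?p\<close> order.trans [OF a mult_right_mono [OF s]]
    by (intro mult_left_mono mult_mono) (auto simp: k)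
  also have "\<dots> = real s * (pochhammer (real m) (n - 1) * (real n * real m - (real n - 1) * real m + (2 * real n - 1)))"
    by (simp add: k pochhammer_rec algebra_simps)
  finally show ?thesis .
qed

text \<open>
  The comparison of factors made at \<open>t = gm\<close> fails for \<open>t\<close> close to \<open>m\<close>, where \<open>j/t\<close> is no longer
  small compared with \<open>1/m\<close>; convexity in \<open>t\<close> reduces the whole interval to its two end points.
\<close>

lemma P_nonpos_below_root:
  fixes g t :: real
  assumes n: "n \<ge> 3" and m: "m \<ge> 1" and g: "real (n * (n + 1)) \<le> g"
    and root: "g ^ n = real s * (real n * g - (real n - 1))" and s: "real n \<le> real s"
    and t: "real m \<le> t" "t \<le> g * real m"
  shows "pochhammer (t + 1) n \<le> real s *
    (pochhammer (real m) (n - 1) * (real n * t - (real n - 1) * real m + (2 * real n - 1)))"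
proof -
  define F where "F x = pochhammer (x + 1) n" for x :: real
  define L where "L x = real s *
    (pochhammer (real m) (n - 1) * (real n * x - (real n - 1) * real m + (2 * real n - 1)))" for x
  have "1 * 3 \<le> n * (n + 1)" using n by (intro mult_le_mono) auto
  then have "1 < real (n * (n + 1))" by linarith
  then have "g > 1" using g by linarith
  \<comment> \<open>\<open>t\<close> is the convex combination of \<open>m\<close> and \<open>gm\<close> with weights \<open>u\<close> and \<open>v\<close>.\<close>
  define d where "d = g * real m - real m"
  have "d > 0" using \<open>g > 1\<close> m by (simp add: d_def)
  define v where "v = (t - real m) / d"
  define u where "u = 1 - v"
  have uv: "0 \<le> u" "0 \<le> v" "u + v = 1"
    using t \<open>d > 0\<close> by (auto simp: u_def v_def d_def field_simps)
  have "v * d = t - real m"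
    using \<open>d > 0\<close> by (simp add: v_def)
  then have t_eq: "t = u * real m + v * (g * real m)"
    by (simp add: u_def d_def algebra_simps)
  have "F t \<le> u * F (real m) + v * F (g * real m)"
    unfolding t_eq F_def using convex_pochhammer [of n] uv \<open>g > 1\<close>
    by (auto simp: convex_on_def)
  also have "\<dots> \<le> u * L (real m) + v * L (g * real m)"
    unfolding F_def L_def using n m g root s uv
    by (intro add_mono mult_left_mono P_nonpos_at_root P_nonpos_at_diagonal) auto
  also have "\<dots> = L t"
  proof -
    have L: "L x = real s * pochhammer (real m) (n - 1) * real n * x + L 0" for x
      by (simp add: L_def algebra_simps)
    show ?thesis
      unfolding u_def t_eq L [of "(1 - v) * real m + v * (g * real m)"] L [of "real m"] L [of "g * real m"]
      by (simp add: algebra_simps)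
  qed
  finally show ?thesis by (simp add: F_def L_def)
qed

section \<open>Positivity beyond the largest root\<close>

text \<open>
  Divided by \<open>m^n\<close>, the left-hand side tends to \<open>s (ny - (n-1)) < y^n\<close>, while the right-hand side
  is at least \<open>(ym)^n / m^n = y^n\<close>.
\<close>

lemma P_pos_eventually:
  fixes y :: real
  assumes n: "n \<ge> 2" and y: "y > 0" and big: "real s * (real n * y - (real n - 1)) < y ^ n"
  shows "eventually (\<lambda>m. real s *
    (pochhammer (real m) (n - 1) * (real n * (y * real m) - (real n - 1) * real m + (2 * real n - 1)))
      < pochhammer (y * real m + 1) n) sequentially"
proof -
  have inv: "(\<lambda>m. c / real m) \<longlonglongrightarrow> 0" for c
    by (rule tendsto_divide_0 [OF tendsto_const]) (simp add: filterlim_real_sequentially filterlim_at_top_imp_at_infinity)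
  have "(\<lambda>m. real s * ((\<Prod>j<n - 1. 1 + real j / real m)
        * (real n * y - (real n - 1) + (2 * real n - 1) / real m)))
      \<longlonglongrightarrow> real s * ((\<Prod>j<n - 1. 1 + 0) * (real n * y - (real n - 1) + 0))"
    by (intro tendsto_intros inv)
  then have "eventually (\<lambda>m. real s * ((\<Prod>j<n - 1. 1 + real j / real m)
        * (real n * y - (real n - 1) + (2 * real n - 1) / real m)) < y ^ n) sequentially"
    using big by (auto intro: order_tendstoD)
  then show ?thesis
    using eventually_gt_at_top [of 0]
  proof eventually_elim
    case (elim m)
    have "pochhammer (real m) (n - 1) = (\<Prod>j<n - 1. real m * (1 + real j / real m))"
      unfolding pochhammer_prod lessThan_atLeast0
      using elim by (intro prod.cong) (auto simp: field_simps)
    then have poch: "pochhammer (real m) (n - 1) = real m ^ (n - 1) * (\<Prod>j<n - 1. 1 + real j / real m)"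
      by (simp add: prod.distrib)
    have pow: "real m ^ n = real m ^ (n - 1) * real m"
      using n by (cases n) auto
    have "real s * (pochhammer (real m) (n - 1) * (real n * (y * real m) - (real n - 1) * real m + (2 * real n - 1)))
        = real m ^ n * (real s * ((\<Prod>j<n - 1. 1 + real j / real m)
        * (real n * y - (real n - 1) + (2 * real n - 1) / real m)))"
      unfolding poch pow using elim by (simp add: field_simps)
    also have "\<dots> < real m ^ n * y ^ n"
      using elim by (intro mult_strict_left_mono) auto
    also have "\<dots> = (\<Prod>i=0..<n. y * real m)"
      by (simp add: power_mult_distrib)
    also have "\<dots> \<le> pochhammer (y * real m + 1) n"
      unfolding pochhammer_prod using y by (intro prod_mono) auto
    finally show ?case .
  qed
qed

section \<open>The infimum is the largest root\<close>

theorem theorem3p2: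
  fixes n :: nat
  assumes "n \<ge> 3"
  shows "\<exists>s0 :: nat. \<forall>s\<ge>s0. e_inf n 1 s = g_root n 1 s"
proof (intro exI allI impI)
  fix s :: nat assume s: "s \<ge> (n * (n + 1)) ^ n"
  define K where "K = real (n * (n + 1))"
  define g where "g = g_root n 1 s"
  have n2: "n \<ge> 2" using assms by simp
  have "1 * 1 \<le> n * (n + 1)" using assms by (intro mult_le_mono) auto
  then have K: "K \<ge> 1" unfolding K_def by linarith
  have sK: "K ^ n \<le> real s"
    unfolding K_def using s by (metis of_nat_le_iff of_nat_power)
  note g_props = g_root_largest [OF n2 K sK, folded g_def]
  have "n \<le> n * (n + 1)" by simp
  also have "\<dots> \<le> (n * (n + 1)) ^ n" using assms by (intro self_le_power) auto
  finally have ns: "real n \<le> real s" using s by linarith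
  show "e_inf n 1 s = g_root n 1 s"
    unfolding e_inf_def g_def [symmetric]
  proof (rule cInf_eq)
    fix x assume "x \<in> {real_of_int t / real m | (t :: int) (m :: nat).
            t \<ge> int m \<and> m \<ge> 1 \<and> poly (P_poly n 1 s m) (of_int t) > 0}"
    then obtain t m where x: "x = real_of_int t / real m" and t: "t \<ge> int m" and m: "m \<ge> 1"
      and pos: "poly (P_poly n 1 s m) (of_int t) > 0" by auto
    show "g \<le> x"
    proof (rule ccontr)
      assume "\<not> g \<le> x"
      then have "real_of_int t \<le> g * real m"
        using m by (simp add: x field_simps)
      moreover have "real m \<le> real_of_int t" using t by linarith
      ultimately show False
        using P_nonpos_below_root [OF assms m _ g_props(2) ns] g_props(1) pos
        unfolding K_def P_poly_pos_iff [OF n2] by force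
    qed
  next
    fix y assume y: "\<And>x. x \<in> {real_of_int t / real m | (t :: int) (m :: nat).
            t \<ge> int m \<and> m \<ge> 1 \<and> poly (P_poly n 1 s m) (of_int t) > 0} \<Longrightarrow> y \<le> x"
    show "y \<le> g"
    proof (rule ccontr)
      assume "\<not> y \<le> g"
      then obtain z where z: "z \<in> \<rat>" "g < z" "z < y"
        using Rats_dense_in_real [of g y] by auto
      obtain p q where q: "q > 0" and zpq: "z = real_of_int p / real_of_int q"
        using z(1) by (auto elim!: Rats_cases')
      have z1: "z > 1" using z(2) g_props(1) K by simp
      from P_pos_eventually [OF n2 _ g_props(3) [OF z(2)]] z1
      obtain N where N: "\<And>m. m \<ge> N \<Longrightarrow> real s *
        (pochhammer (real m) (n - 1) * (real n * (z * real m) - (real n - 1) * real m + (2 * real n - 1)))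
        < pochhammer (z * real m + 1) n"
        by (auto simp: eventually_sequentially)
      \<comment> \<open>\<open>m\<close> is a multiple of the denominator of \<open>z\<close>, so that \<open>zm\<close> is an integer, and exceeds \<open>N\<close>.\<close>
      define m where "m = nat q * (N + 1)"
      define t where "t = p * int (N + 1)"
      have qm: "real m = real_of_int q * (real N + 1)" using q by (simp add: m_def algebra_simps)
      have zt: "z * real m = real_of_int t"
        using q by (simp add: qm t_def zpq)
      have "1 * (N + 1) \<le> m"
        unfolding m_def using q by (intro mult_le_mono) auto
      then have m1: "m \<ge> 1" "m \<ge> N" by auto
      have "1 * real m < z * real m"
        using z1 m1 by (intro mult_strict_right_mono) auto
      then have "t \<ge> int m" using zt by simp
      moreover have "poly (P_poly n 1 s m) (of_int t) > 0"
        unfolding P_poly_pos_iff [OF n2] using N [OF m1(2)] unfolding zt .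
      moreover have "z = real_of_int t / real m"
        using zt m1 by (simp add: field_simps)
      ultimately have "y \<le> z"
        using m1 by (intro y) auto
      then show False using z by simp
    qed
  qed
qed

end
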